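(* Let $(\mathbb{X},d)$ be a metric space with $|\mathbb{X}|\geq 3$. Then $(\mathbb{X},d)$ is complete if and only if every weak contraction map $T:\mathbb{X}\to\mathbb{X}$ on the perimeters of triangles in $\mathbb{X}$ satisfying $T^2x\neq x$ for every $x\in\mathbb{X}$ with $Tx\neq x$ has a fixed point in $\mathbb{X}$.
   Context: Let $(\mathbb{X},d)$ be a metric space with at least three points. A mapping $T:\mathbb{X}\to\mathbb{X}$ is called a weak contraction map on the perimeters of triangles in $\mathbb{X}$ if there exists $k\in(0,1)$ such that for every three pairwise distinct points $x,y,z\in\mathbb{X}$, $$d(Tx,Ty)+d(Ty,Tz)+d(Tz,Tx)\leq k\max\big\{d(x',y')+d(y',z')+d(z',x') : x',y',z'\in\{x,y,z,Tx,Ty,Tz\},\ x',y',z'\text{ pairwise distinct}\big\}.$$ *)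

theory Defs
  imports "HOL-Analysis.Analysis"
begin

definition perimeter :: "'a::metric_space \<Rightarrow> 'a \<Rightarrow> 'a \<Rightarrow> real" where
  "perimeter x y z = dist x y + dist y z + dist z x"

definition pairwise_distinct3 :: "'a \<Rightarrow> 'a \<Rightarrow> 'a \<Rightarrow> bool" where
  "pairwise_distinct3 x y z \<longleftrightarrow> x \<noteq> y \<and> y \<noteq> z \<and> z \<noteq> x"

definition triangle_perimeters :: "'a::metric_space set \<Rightarrow> real set" where
  "triangle_perimeters S =
     {perimeter x y z | x y z. x \<in> S \<and> y \<in> S \<and> z \<in> S \<and> pairwise_distinct3 x y z}"

text \<open>The maximum below is taken over a finite set, which is nonempty because the
  pairwise distinct points \<open>x\<close>, \<open>y\<close>, \<open>z\<close> themselves form a triangle.\<close>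

definition weak_perimeter_contraction :: "('a::metric_space \<Rightarrow> 'a) \<Rightarrow> bool" where
  "weak_perimeter_contraction T \<longleftrightarrow>
     (\<exists>k::real. 0 < k \<and> k < 1 \<and>
       (\<forall>x y z. pairwise_distinct3 x y z \<longrightarrow>
          perimeter (T x) (T y) (T z)
            \<le> k * Max (triangle_perimeters {x, y, z, T x, T y, T z})))"

end

theory Submission imports Defs begin

text \<open>For the forward direction, let \<open>T\<close> have no fixed point and no point of period two. Three
  consecutive points of an orbit are then distinct. A triangle in the orbit that avoids the initial
  point is the image of a triangle, so its perimeter is at most \<open>k\<close> times the largest perimeter in
  the orbit segment; exchanging the initial point for one of the next three points costs only a
  constant, so the perimeters along the orbit are bounded. Hence they decay geometrically, the
  orbit is Cauchy, and a triangle formed by the limit \<open>p\<close> and two consecutive orbit points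
  gives \<open>2 d(p, T p) \<le> 2 k d(p, T p)\<close>, which is a contradiction.

  Conversely, a Cauchy sequence without limit yields a positive function \<open>r\<close>, the distance to the
  missing limit, with infimum zero. Any \<open>T\<close> with \<open>7 r(T x) \<le> r(x)\<close> is a weak contraction
  without periodic points.\<close>

section \<open>Bounds on the perimeters of triangles\<close>

definition perimeters_bounded :: "'a::metric_space set \<Rightarrow> real \<Rightarrow> bool" where
  "perimeters_bounded S B \<longleftrightarrow>
     (\<forall>x\<in>S. \<forall>y\<in>S. \<forall>z\<in>S. pairwise_distinct3 x y z \<longrightarrow> perimeter x y z \<le> B)"

lemma perimeters_boundedD:
  assumes "perimeters_bounded S B" "x \<in> S" "y \<in> S" "z \<in> S" "x \<noteq> y" "y \<noteq> z" "z \<noteq> x"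
  shows "perimeter x y z \<le> B"
  using assms by (auto simp: perimeters_bounded_def pairwise_distinct3_def)

lemma perimeter_rotate: "perimeter x y z = perimeter y z x"
  by (simp add: perimeter_def)

lemma perimeter_exchange: "perimeter x y z \<le> 2 * dist x a + perimeter a y z"
  using dist_triangle[of x y a] dist_triangle[of z x a]
  by (simp add: perimeter_def dist_commute)

lemma finite_triangle_perimeters:
  assumes "finite S"
  shows "finite (triangle_perimeters S)"
proof (rule finite_subset)
  show "triangle_perimeters S \<subseteq> (\<lambda>(x, y, z). perimeter x y z) ` (S \<times> S \<times> S)"
    by (force simp: triangle_perimeters_def)
qed (use assms in auto)

lemma perimeters_bounded_Max:
  assumes "finite S"
  shows "perimeters_bounded S (Max (triangle_perimeters S))"
  unfolding perimeters_bounded_def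
proof (intro ballI impI)
  fix x y z assume "x \<in> S" "y \<in> S" "z \<in> S" "pairwise_distinct3 x y z"
  then have "perimeter x y z \<in> triangle_perimeters S"
    unfolding triangle_perimeters_def by blast
  then show "perimeter x y z \<le> Max (triangle_perimeters S)"
    by (intro Max_ge finite_triangle_perimeters assms)
qed

lemma Max_triangle_perimeters_le:
  assumes "finite S" "x \<in> S" "y \<in> S" "z \<in> S" "pairwise_distinct3 x y z"
    and "perimeters_bounded S B"
  shows "Max (triangle_perimeters S) \<le> B"
proof (rule Max.boundedI)
  show "triangle_perimeters S \<noteq> {}"
    using assms unfolding triangle_perimeters_def by blast
  show "b \<le> B" if "b \<in> triangle_perimeters S" for b
    using that assms(6) unfolding triangle_perimeters_def perimeters_bounded_def by blast
qed (intro finite_triangle_perimeters assms)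

text \<open>\<open>Max\<close> is meaningful only for finite sets, whereas the orbit tails and balls
  used later may be infinite. The contraction is therefore recast with any upper bound valid on any
  set that contains the six points.\<close>

lemma weak_perimeter_contractionE:
  assumes "weak_perimeter_contraction T"
  obtains k :: real where "0 < k" "k < 1"
    "\<And>x y z S B. \<lbrakk>x \<noteq> y; y \<noteq> z; z \<noteq> x; {x, y, z, T x, T y, T z} \<subseteq> S; perimeters_bounded S B\<rbrakk>
       \<Longrightarrow> perimeter (T x) (T y) (T z) \<le> k * B"
proof -
  obtain k where k: "0 < k" "k < 1" and T: "\<And>x y z. pairwise_distinct3 x y z \<Longrightarrow>
      perimeter (T x) (T y) (T z) \<le> k * Max (triangle_perimeters {x, y, z, T x, T y, T z})"
    using assms unfolding weak_perimeter_contraction_def by blast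
  have "perimeter (T x) (T y) (T z) \<le> k * B"
    if "x \<noteq> y" "y \<noteq> z" "z \<noteq> x" "{x, y, z, T x, T y, T z} \<subseteq> S" "perimeters_bounded S B"
    for x y z S B
  proof -
    have xyz: "pairwise_distinct3 x y z"
      using that by (simp add: pairwise_distinct3_def)
    have "perimeters_bounded {x, y, z, T x, T y, T z} B"
      using that(4,5) unfolding perimeters_bounded_def by blast
    then have "Max (triangle_perimeters {x, y, z, T x, T y, T z}) \<le> B"
      by (intro Max_triangle_perimeters_le[OF _ _ _ _ xyz]) auto
    then show ?thesis
      using T[OF xyz] k(1) by (meson mult_left_mono less_imp_le order_trans)
  qed
  then show thesis using that k by blast
qed

lemma perimeters_bounded_mono:
  assumes "perimeters_bounded S B" "B \<le> B'"
  shows "perimeters_bounded S B'"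
  using assms unfolding perimeters_bounded_def by force

text \<open>The other two vertices of a triangle at \<open>x\<close> occupy at most two of
  \<open>a\<close>, \<open>b\<close>, \<open>c\<close>, so one of these can replace \<open>x\<close>
  and gives a triangle inside \<open>S\<close>. By \<open>perimeter_exchange\<close> this costs at
  most twice its distance from \<open>x\<close>.\<close>

lemma perimeters_bounded_insert:
  assumes "perimeters_bounded S B" "distinct [a, b, c]" "a \<in> S" "b \<in> S" "c \<in> S"
  shows "perimeters_bounded (insert x S) (2 * (dist x a + dist x b + dist x c) + B)"
    (is "perimeters_bounded _ ?B")
proof -
  have x: "perimeter x y z \<le> ?B" if "y \<in> S" "z \<in> S" "y \<noteq> z" for y z
  proof -
    obtain e where e: "e \<in> {a, b, c}" "e \<noteq> y" "e \<noteq> z"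
      using assms(2) by (metis distinct_length_2_or_more insertCI)
    have "perimeter e y z \<le> B"
      using e that assms by (intro perimeters_boundedD[OF assms(1)]) auto
    moreover have "dist x e \<le> dist x a + dist x b + dist x c"
      using e(1) by auto
    ultimately show ?thesis
      using perimeter_exchange[of x y z e] by argo
  qed
  have B: "B \<le> ?B" by simp
  show ?thesis
    unfolding perimeters_bounded_def
  proof (intro ballI impI)
    fix u v w
    assume S: "u \<in> insert x S" "v \<in> insert x S" "w \<in> insert x S" and d: "pairwise_distinct3 u v w"
    consider "u = x" | "v = x" | "w = x" | "u \<in> S" "v \<in> S" "w \<in> S" using S by blast
    then show "perimeter u v w \<le> ?B"
    proof cases
      case 1
      then show ?thesis using S d x[of v w] by (auto simp: pairwise_distinct3_def)
    next
      case 2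
      then show ?thesis
        using S d x[of w u] by (auto simp: pairwise_distinct3_def perimeter_rotate[of u])
    next
      case 3
      then show ?thesis
        using S d x[of u v] by (auto simp: pairwise_distinct3_def perimeter_rotate[of x])
    next
      case 4
      then have "perimeter u v w \<le> B"
        using d by (intro perimeters_boundedD[OF assms(1)]) (auto simp: pairwise_distinct3_def)
      then show ?thesis using B by linarith
    qed
  qed
qed

text \<open>At most one vertex is \<open>q\<close>. Then the two sides at \<open>q\<close>
  contribute at most \<open>2 * dist p q + 2 * e\<close> and the third at most \<open>2 * e\<close>.
  A triangle inside the ball has perimeter at most \<open>6 * e\<close>, which explains the
  constant.\<close>

lemma perimeters_bounded_near:
  "perimeters_bounded (insert q (ball p e)) (2 * dist p q + 6 * e)"
proof -
  have q: "perimeter q y z \<le> 2 * dist p q + 6 * e" if "y \<in> ball p e" "z \<in> ball p e" for y z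
    using that dist_triangle3[of y z p] dist_triangle3[of q y p] dist_triangle3[of z q p]
      zero_le_dist[of p y] zero_le_dist[of p z]
    unfolding mem_ball perimeter_def dist_commute[of y q] dist_commute[of z q]
      dist_commute[of q p] dist_commute[of y p] dist_commute[of z p]
    by (smt (verit) dist_commute)
  have b: "perimeter x y z \<le> 2 * dist p q + 6 * e"
    if "x \<in> ball p e" "y \<in> ball p e" "z \<in> ball p e" for x y z
    using that dist_triangle3[of y z p] dist_triangle3[of x y p] dist_triangle3[of z x p]
      zero_le_dist[of p q]
    unfolding mem_ball perimeter_def by linarith
  show ?thesis
    unfolding perimeters_bounded_def
  proof (intro ballI impI)
    fix u v w
    assume S: "u \<in> insert q (ball p e)" "v \<in> insert q (ball p e)" "w \<in> insert q (ball p e)"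
      and d: "pairwise_distinct3 u v w"
    consider "u = q" "v \<in> ball p e" "w \<in> ball p e" | "v = q" "u \<in> ball p e" "w \<in> ball p e"
      | "w = q" "u \<in> ball p e" "v \<in> ball p e" | "u \<in> ball p e" "v \<in> ball p e" "w \<in> ball p e"
      using S d unfolding pairwise_distinct3_def by blast
    then show "perimeter u v w \<le> 2 * dist p q + 6 * e"
      by cases (metis q b perimeter_rotate)+
  qed
qed

section \<open>Complete spaces: existence of a fixed point\<close>

lemma weak_perimeter_contraction_fixed_point:
  fixes T :: "'a::metric_space \<Rightarrow> 'a"
  assumes complete: "complete (UNIV :: 'a set)"
    and T: "weak_perimeter_contraction T"
    and no_period2: "\<And>x. T x \<noteq> x \<Longrightarrow> T (T x) \<noteq> x"
  shows "\<exists>x. T x = x"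
proof (rule ccontr)
  assume "\<nexists>x. T x = x"
  then have ne1: "T x \<noteq> x" and ne2: "T (T x) \<noteq> x" for x
    using no_period2 by auto
  obtain k where k: "0 < k" "k < 1"
    and contr: "\<And>x y z S B. \<lbrakk>x \<noteq> y; y \<noteq> z; z \<noteq> x; {x, y, z, T x, T y, T z} \<subseteq> S;
       perimeters_bounded S B\<rbrakk> \<Longrightarrow> perimeter (T x) (T y) (T z) \<le> k * B"
    using weak_perimeter_contractionE[OF T] by metis
  \<comment> \<open>Points with distinct images are distinct, so a triangle of image points always
    comes from a triangle in \<open>A\<close>.\<close>
  have image_bounded: "perimeters_bounded (T ` A) (k * B)"
    if "perimeters_bounded S B" "A \<union> T ` A \<subseteq> S" for A S B
    unfolding perimeters_bounded_def
  proof (clarsimp simp: pairwise_distinct3_def)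
    fix x y z assume "x \<in> A" "y \<in> A" "z \<in> A" "T x \<noteq> T y" "T y \<noteq> T z" "T z \<noteq> T x"
    then show "perimeter (T x) (T y) (T z) \<le> k * B"
      using that by (intro contr[of x y z S]) auto
  qed
  \<comment> \<open>Any starting point will do; \<open>undefined\<close> stands for an arbitrary
    one.\<close>
  define s where "s n = (T ^^ n) undefined" for n
  have sSuc: "s (Suc n) = T (s n)" for n
    by (simp add: s_def)
  have shift: "T ` s ` A = s ` Suc ` A" for A
    by (simp add: image_image sSuc)
  have dist1: "s (Suc n) \<noteq> s n" and dist2: "s (Suc (Suc n)) \<noteq> s n" for n
    by (simp_all add: sSuc ne1 ne2)
  define C where "C = 2 * (dist (s 0) (s 1) + dist (s 0) (s 2) + dist (s 0) (s 3))"
  \<comment> \<open>On a finite segment \<open>M\<close> is a genuine maximum, so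
    \<open>M <= C + k * M\<close> can be solved for \<open>M\<close>, and the result does not depend
    on \<open>n\<close>. The condition on \<open>n\<close> puts the exchange points
    \<open>s 1\<close>, \<open>s 2\<close>, \<open>s 3\<close> into the segment.\<close>
  have segment: "perimeters_bounded (s ` {..n}) (C / (1 - k))" if "n \<ge> 3" for n
  proof -
    define M where "M = Max (triangle_perimeters (s ` {..n}))"
    have M: "perimeters_bounded (s ` {..n}) M"
      unfolding M_def by (rule perimeters_bounded_Max) simp
    have img: "T ` s ` {..<n} = s ` {1..n}"
      using image_Suc_lessThan by (metis shift)
    have "perimeters_bounded (s ` {1..n}) (k * M)"
      using image_bounded[OF M, of "s ` {..<n}"] unfolding img by (force simp: less_imp_le)
    then have "perimeters_bounded (insert (s 0) (s ` {1..n})) (C + k * M)"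
      unfolding C_def
    proof (rule perimeters_bounded_insert)
      show "distinct [s 1, s 2, s 3]"
        using dist1[of 1] dist1[of 2] dist2[of 1] by (auto simp: numeral_2_eq_2 numeral_3_eq_3)
    qed (use that in auto)
    moreover have "insert (s 0) (s ` {1..n}) = s ` {..n}"
      unfolding image_insert[symmetric] by (rule arg_cong[where f = "image s"]) auto
    ultimately have bounded: "perimeters_bounded (s ` {..n}) (C + k * M)" by simp
    have "M \<le> C + k * M"
      unfolding M_def
    proof (rule Max_triangle_perimeters_le)
      show "pairwise_distinct3 (s 0) (s 1) (s 2)"
        using dist1[of 0] dist1[of 1] dist2[of 0]
        by (auto simp: pairwise_distinct3_def numeral_2_eq_2)
    qed (use that bounded M_def in auto)
    then have "M \<le> C / (1 - k)"
      using k by (simp add: field_simps)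
    then show ?thesis using M perimeters_bounded_mono by blast
  qed
  define B where "B = C / (1 - k)"
  have tail: "perimeters_bounded (s ` {m..}) (k ^ m * B)" for m
  proof (induction m)
    case 0
    have "perimeter (s i) (s j) (s l) \<le> B" if "pairwise_distinct3 (s i) (s j) (s l)" for i j l
      using that segment[of "Max {i, j, l, 3}"] unfolding perimeters_bounded_def B_def by auto
    then show ?case by (auto simp: perimeters_bounded_def)
  next
    case (Suc m)
    have "Suc ` {m..} = {Suc m..}"
      by (auto simp: Suc_le_eq image_def dest: Suc_le_D)
    then have "T ` s ` {m..} = s ` {Suc m..}"
      by (simp only: shift)
    moreover have "s ` {Suc m..} \<subseteq> s ` {m..}" by auto
    ultimately show ?case
      using image_bounded[OF Suc, of "s ` {m..}"] by (simp add: mult.assoc)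
  qed
  have dist_le: "dist (s n) (s N) \<le> k ^ N * B" if "N \<le> n" for n N
  proof (cases "s n = s N")
    case True
    \<comment> \<open>Only \<open>0 <= k ^ N * B\<close> is at stake here; it follows because this
      number bounds the perimeter of an actual triangle.\<close>
    have "perimeter (s N) (s (Suc N)) (s (Suc (Suc N))) \<le> k ^ N * B"
      using dist1[of N] dist1[of "Suc N"] dist2[of N]
      by (intro perimeters_boundedD[OF tail[of N]]) auto
    moreover have "0 \<le> perimeter (s N) (s (Suc N)) (s (Suc (Suc N)))"
      by (simp add: perimeter_def)
    ultimately show ?thesis using True by simp
  next
    case False
    \<comment> \<open>A third vertex is needed for a triangle on \<open>s n\<close> and
      \<open>s N\<close>; one of the next two orbit points after \<open>s N\<close> is always
      free.\<close>
    define j where "j = (if s n = s (Suc N) then Suc (Suc N) else Suc N)"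
    have j: "j \<ge> N" "s j \<noteq> s n" "s j \<noteq> s N"
      using dist1[of N] dist1[of "Suc N"] dist2[of N] by (auto simp: j_def)
    have "perimeter (s n) (s N) (s j) \<le> k ^ N * B"
      using False j that by (intro perimeters_boundedD[OF tail[of N]]) auto
    then show ?thesis
      unfolding perimeter_def using zero_le_dist[of "s N" "s j"] zero_le_dist[of "s j" "s n"]
      by linarith
  qed
  have "Cauchy s"
    unfolding Cauchy_altdef2
  proof (intro allI impI)
    fix e :: real assume "e > 0"
    have "(\<lambda>N. k ^ N * B) \<longlonglongrightarrow> 0"
      using k by (intro tendsto_mult_left_zero LIMSEQ_power_zero) simp
    then have "\<forall>\<^sub>F N in sequentially. k ^ N * B < e"
      using \<open>e > 0\<close> by (rule order_tendstoD)
    then obtain N where "k ^ N * B < e"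
      by (auto simp: eventually_sequentially)
    then show "\<exists>N. \<forall>n\<ge>N. dist (s n) (s N) < e"
      using dist_le by (meson le_less_trans)
  qed
  then obtain p where p: "s \<longlonglongrightarrow> p"
    using complete unfolding complete_def by blast
  define d where "d = dist p (T p)"
  \<comment> \<open>The estimates below end in \<open>(1 - k) * d <= 4 * e\<close>, which this
    choice contradicts.\<close>
  define e where "e = (1 - k) * d / 5"
  have d: "d > 0" using ne1[of p] by (simp add: d_def)
  then have e: "e > 0" using k by (simp add: e_def)
  obtain N where N: "\<And>n. n \<ge> N \<Longrightarrow> dist (s n) p < e"
    using p e unfolding lim_sequentially by blast
  have near: "s (N + i) \<in> ball p e" for i
    using N[of "N + i"] by (simp add: dist_commute)
  \<comment> \<open>If an orbit point from \<open>N\<close> on were \<open>p\<close>, its successor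
    would be \<open>T p\<close>, which lies outside the ball.\<close>
  have "e < d" using d k by (simp add: e_def field_simps add_pos_pos)
  then have s_ne_p: "s (N + i) \<noteq> p" for i
    using near[of "Suc i"] by (auto simp: sSuc d_def)
  \<comment> \<open>Of the six points involved, all but \<open>T p\<close> lie in the ball around
    \<open>p\<close>.\<close>
  have "perimeter (T p) (T (s N)) (T (s (Suc N))) \<le> k * (2 * dist p (T p) + 6 * e)"
    using near[of 0] near[of 1] near[of 2] e s_ne_p[of 0] s_ne_p[of 1] dist1[of N]
    by (intro contr[OF _ _ _ _ perimeters_bounded_near])
       (auto simp: sSuc[symmetric] numeral_2_eq_2)
  moreover have "dist (T p) (s (Suc N)) + dist (T p) (s (Suc (Suc N)))
      \<le> perimeter (T p) (T (s N)) (T (s (Suc N)))"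
    by (simp add: perimeter_def sSuc dist_commute)
  moreover have "2 * (d - e) \<le> dist (T p) (s (Suc N)) + dist (T p) (s (Suc (Suc N)))"
    using near[of 1] near[of 2] dist_triangle2[of p "T p" "s (Suc N)"]
      dist_triangle[of p "T p" "s (Suc (Suc N))"]
    by (simp add: d_def numeral_2_eq_2 dist_commute)
  ultimately have "d - e \<le> k * d + 3 * (k * e)" by (simp add: d_def algebra_simps)
  moreover have "k * e \<le> e" using k e by simp
  moreover have "5 * e = d - k * d" by (simp add: e_def left_diff_distrib)
  ultimately show False using e by linarith
qed

section \<open>Incomplete spaces: a contraction without fixed points\<close>

lemma incomplete_distance_to_missing_limit:
  assumes "\<not> complete (UNIV :: 'a::metric_space set)"
  obtains r :: "'a::metric_space \<Rightarrow> real" where "\<And>x. 0 < r x" "\<And>x y. r x \<le> dist x y + r y"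
    "\<And>x y. dist x y \<le> r x + r y" "\<And>e. 0 < e \<Longrightarrow> \<exists>x. r x < e"
proof -
  obtain s :: "nat \<Rightarrow> 'a" where s: "Cauchy s" "\<And>l. \<not> s \<longlonglongrightarrow> l"
    using assms unfolding complete_def by auto
  \<comment> \<open>This is the distance to the limit of \<open>s\<close> in the completion,
    expressed without leaving the space. It cannot vanish at \<open>x\<close>, since
    \<open>s\<close> would then converge to \<open>x\<close>.\<close>
  define r where "r x = lim (\<lambda>n. dist x (s n))" for x
  have "convergent (\<lambda>n. dist x (s n))" for x
  proof -
    have "Cauchy (\<lambda>n. dist x (s n))"
      unfolding Cauchy_def
    proof (intro allI impI)
      fix e :: real assume "e > 0"
      then obtain M where "\<forall>m\<ge>M. \<forall>n\<ge>M. dist (s m) (s n) < e"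
        using s(1) unfolding Cauchy_def by blast
      moreover have "dist (dist x (s m)) (dist x (s n)) \<le> dist (s m) (s n)" for m n
        using dist_triangle[of x "s m" "s n"] dist_triangle[of x "s n" "s m"]
        by (simp add: dist_real_def dist_commute)
      ultimately show "\<exists>M. \<forall>m\<ge>M. \<forall>n\<ge>M. dist (dist x (s m)) (dist x (s n)) < e"
        by (meson le_less_trans)
    qed
    then show ?thesis by (rule Cauchy_convergent)
  qed
  then have r: "(\<lambda>n. dist x (s n)) \<longlonglongrightarrow> r x" for x
    by (simp add: r_def convergent_LIMSEQ_iff)
  show thesis
  proof
    show "0 < r x" for x
    proof -
      have "r x \<noteq> 0"
        using r[of x] s(2)[of x] by (auto simp: tendsto_dist_iff[of s] dist_commute)
      moreover have "0 \<le> r x"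
        using r[of x] by (rule LIMSEQ_le_const) simp
      ultimately show ?thesis by simp
    qed
    show "r x \<le> dist x y + r y" for x y
      by (rule LIMSEQ_le[OF r tendsto_add[OF tendsto_const r]]) (simp add: dist_triangle)
    show "dist x y \<le> r x + r y" for x y
      by (rule LIMSEQ_le_const[OF tendsto_add[OF r r]]) (simp add: dist_triangle2)
    show "\<exists>x. r x < e" if "0 < e" for e
    proof -
      \<comment> \<open>Passing to the limit weakens the strict inequality, so \<open>e / 2\<close>
        leaves room.\<close>
      obtain N where N: "\<forall>m\<ge>N. \<forall>n\<ge>N. dist (s m) (s n) < e / 2"
        using s(1) \<open>0 < e\<close> unfolding Cauchy_def by (metis half_gt_zero)
      then have "r (s N) \<le> e / 2"
        by (intro LIMSEQ_le_const2[OF r]) (auto intro: less_imp_le)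
      then show ?thesis using that by (intro exI[of _ "s N"]) simp
    qed
  qed
qed

lemma incomplete_fixed_point_free_contraction:
  assumes "\<not> complete (UNIV :: 'a::metric_space set)"
  obtains T :: "'a::metric_space \<Rightarrow> 'a" where "weak_perimeter_contraction T"
    "\<And>x. T x \<noteq> x" "\<And>x. T (T x) \<noteq> x"
proof -
  obtain r :: "'a \<Rightarrow> real" where pos: "\<And>x. 0 < r x" and lip: "\<And>x y. r x \<le> dist x y + r y"
    and dist: "\<And>x y. dist x y \<le> r x + r y" and inf: "\<And>e. 0 < e \<Longrightarrow> \<exists>x. r x < e"
    using incomplete_distance_to_missing_limit[OF assms] by blast
  \<comment> \<open>With the factor \<open>7\<close>, \<open>dist u (T u)\<close> is at least
    \<open>6 / 7 * r u\<close>, so a triangle with this side has perimeter at least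
    \<open>12 / 7 * r u\<close>. The image perimeter is at most \<open>2 / 7\<close> of the sum of
    the three values of \<open>r\<close>, hence at most \<open>2 / 7 * 3 * 7 / 12 = 1 / 2\<close> of
    the maximum.\<close>
  have "\<forall>x. \<exists>y. r y < r x / 7"
    using inf pos by (meson divide_pos_pos zero_less_numeral)
  then obtain T where T: "\<And>x. r (T x) < r x / 7" by metis
  show thesis
  proof
    show ne: "T x \<noteq> x" for x
      using T[of x] pos[of x] by auto
    show "T (T x) \<noteq> x" for x
      using T[of x] T[of "T x"] pos[of x] by auto
    show "weak_perimeter_contraction T"
      unfolding weak_perimeter_contraction_def
    proof (intro exI[of _ "1 / 2"] conjI allI impI)
      fix x y z :: 'a assume xyz: "pairwise_distinct3 x y z"
      let ?S = "{x, y, z, T x, T y, T z}"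
      let ?M = "Max (triangle_perimeters ?S)"
      have M: "12 / 7 * r u \<le> ?M" if u: "u \<in> {x, y, z}" for u
      proof -
        \<comment> \<open>Two of the given points differ from \<open>u\<close>, and at most one of
          them is \<open>T u\<close>.\<close>
        obtain v where v: "v \<in> {x, y, z}" "v \<noteq> u" "v \<noteq> T u"
          using xyz u unfolding pairwise_distinct3_def by auto
        have "perimeter u (T u) v \<le> ?M"
          using u v ne[of u]
          by (intro perimeters_boundedD[OF perimeters_bounded_Max[of ?S]]) auto
        moreover have "2 * dist u (T u) \<le> perimeter u (T u) v"
          using dist_triangle[of u "T u" v] by (simp add: perimeter_def dist_commute)
        ultimately show ?thesis
          using lip[of u "T u"] T[of u] by linarith
      qed
      have "perimeter (T x) (T y) (T z) \<le> 2 * (r (T x) + r (T y) + r (T z))"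
        using dist[of "T x" "T y"] dist[of "T y" "T z"] dist[of "T z" "T x"]
        by (simp add: perimeter_def)
      then show "perimeter (T x) (T y) (T z) \<le> 1 / 2 * ?M"
        using T[of x] T[of y] T[of z] M[of x] M[of y] M[of z] by simp
    qed simp_all
  qed
qed

theorem theorem3p2:
  assumes "\<exists>a b c :: 'a::metric_space. pairwise_distinct3 a b c"
  shows "complete (UNIV :: 'a set) \<longleftrightarrow>
    (\<forall>T :: 'a \<Rightarrow> 'a.
       weak_perimeter_contraction T \<and> (\<forall>x. T x \<noteq> x \<longrightarrow> T (T x) \<noteq> x)
         \<longrightarrow> (\<exists>x. T x = x))"
  using weak_perimeter_contraction_fixed_point incomplete_fixed_point_free_contraction
  by metis

end
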